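(* Let $a,b,k,l,\bar b_1,\bar b_2,\tau$ be positive constants, let $A=\begin{pmatrix}-a&k\\ l&-b\end{pmatrix}$, and assume $\det A=ab-kl>0$. Consider the delay differential system $$x'(t)=k\,y(t-\tau)-a\,x(t-\tau)+\bar b_1,\qquad y'(t)=l\,x(t-\tau)-b\,y(t-\tau)+\bar b_2,$$ and its unique equilibrium, which is positive, $P_0=-A^{-1}\bar b$ with $\bar b=(\bar b_1,\bar b_2)^T$. Then $P_0$ is exponentially asymptotically stable if and only if $\tau<\tau_-$, where $$\tau_-=\frac{\pi}{4\det A}\Big[(a+b)-\sqrt{(a+b)^2-4\det A}\Big].$$ Moreover, the normalized characteristic equation $$\lambda^2+\tau(a+b)\lambda e^{-\lambda}+\tau^2\det A\,e^{-2\lambda}=0$$ has a pair of roots of the form $\pm i\sigma$ with $\sigma>0$ if and only if $\sigma=\sigma_n$ and $\tau=\tau_n^{+}$ or $\tau=\tau_n^-$ for some $n\in\{0,1,2,\dots\}$, where $$\sigma_n=\frac{\pi}{2}+2n\pi,\qquad \tau_n^{\pm}=\sigma_n\left[\frac{(a+b)\pm\sqrt{(a+b)^2-4\det A}}{2\det A}\right],$$ and these roots cross the imaginary axis transversally to the right-hand side as $\tau$ increases through each value $\tau_n^{\pm}$.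
   Context: The phase space is $C=C([-\tau,0];\mathbb R^2)$ with the supremum norm. $P_0$ is exponentially asymptotically stable (EAS) if there are $K,\alpha>0$ such that every solution $X(t)=(x(t),y(t))$ with initial function $\phi\in C$ at time $0$ satisfies $|X(t)-P_0|\le Ke^{-\alpha t}\|\phi-P_0\|$ for all $t\ge 0$. The linearization about $P_0$ is $X'(t)=AX(t-\tau)$; after the time scaling $t\mapsto\tau t$ it becomes $X'(t)=\tau AX(t-1)$, whose characteristic equation is the normalized characteristic equation in the claim. The crossing statement means: for each $n$ and each choice of sign there is a smooth curve $\tau\mapsto\lambda(\tau)$ of roots of the normalized characteristic equation, defined for $\tau$ near $\tau_n^{\pm}$, with $\lambda(\tau_n^\pm)=i\sigma_n$ and $\mathrm{Re}\,\lambda'(\tau_n^\pm)>0$. *)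

theory Defs
  imports "HOL-Analysis.Analysis"
begin

text \<open>
  A solution of the autonomous delay equation \<open>X'(t) = f (X (t - \<tau>))\<close> with initial
  function \<open>\<phi>\<close> at time \<open>0\<close>. Only the values of \<open>X\<close> on \<open>[-\<tau>, \<infinity>)\<close> matter; the derivative
  at \<open>t = 0\<close> is the right-hand one.
\<close>
definition delay_solution ::
  "real \<Rightarrow> ('v \<Rightarrow> 'v) \<Rightarrow> (real \<Rightarrow> 'v) \<Rightarrow> (real \<Rightarrow> 'v::real_normed_vector) \<Rightarrow> bool" where
  "delay_solution \<tau> f \<phi> X \<longleftrightarrow>
     continuous_on {-\<tau>..} X \<and>
     (\<forall>\<theta>\<in>{-\<tau>..0}. X \<theta> = \<phi> \<theta>) \<and>
     (\<forall>t\<ge>0. (X has_vector_derivative f (X (t - \<tau>))) (at t within {0..}))"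

definition phase_norm :: "real \<Rightarrow> (real \<Rightarrow> 'v::real_normed_vector) \<Rightarrow> real" where
  "phase_norm \<tau> \<phi> = (SUP \<theta>\<in>{-\<tau>..0}. norm (\<phi> \<theta>))"

definition exp_asymp_stable ::
  "real \<Rightarrow> ('v \<Rightarrow> 'v) \<Rightarrow> 'v::real_normed_vector \<Rightarrow> bool" where
  "exp_asymp_stable \<tau> f P \<longleftrightarrow>
     (\<exists>K>0. \<exists>\<alpha>>0. \<forall>\<phi> X.
        continuous_on {-\<tau>..0} \<phi> \<longrightarrow> delay_solution \<tau> f \<phi> X \<longrightarrow>
        (\<forall>t\<ge>0. norm (X t - P) \<le> K * exp (- \<alpha> * t) * phase_norm \<tau> (\<lambda>\<theta>. \<phi> \<theta> - P)))"

definition equilibrium :: "('v \<Rightarrow> 'v::real_normed_vector) \<Rightarrow> 'v \<Rightarrow> bool" where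
  "equilibrium f P \<longleftrightarrow> f P = 0"

definition coeff_matrix :: "real \<Rightarrow> real \<Rightarrow> real \<Rightarrow> real \<Rightarrow> real^2^2" where
  "coeff_matrix a b k l = vector [vector [-a, k], vector [l, -b]]"

text \<open>The right-hand side as a function of the delayed state \<open>Z = (x (t - \<tau>), y (t - \<tau>))\<close>.\<close>
definition delay_field ::
  "real \<Rightarrow> real \<Rightarrow> real \<Rightarrow> real \<Rightarrow> real \<Rightarrow> real \<Rightarrow> real^2 \<Rightarrow> real^2" where
  "delay_field a b k l b1 b2 Z =
     vector [k * Z$2 - a * Z$1 + b1, l * Z$1 - b * Z$2 + b2]"

definition P0 :: "real \<Rightarrow> real \<Rightarrow> real \<Rightarrow> real \<Rightarrow> real \<Rightarrow> real \<Rightarrow> real^2" where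
  "P0 a b k l b1 b2 = - (matrix_inv (coeff_matrix a b k l) *v vector [b1, b2])"

definition char_fun :: "real \<Rightarrow> real \<Rightarrow> real \<Rightarrow> real \<Rightarrow> real \<Rightarrow> complex \<Rightarrow> complex" where
  "char_fun a b k l \<tau> z =
     z\<^sup>2 + of_real (\<tau> * (a + b)) * z * exp (- z)
       + of_real (\<tau>\<^sup>2 * det (coeff_matrix a b k l)) * exp (- 2 * z)"

definition tau_crit :: "real \<Rightarrow> real \<Rightarrow> real \<Rightarrow> real \<Rightarrow> real" where
  "tau_crit a b k l =
     pi / (4 * det (coeff_matrix a b k l))
       * ((a + b) - sqrt ((a + b)\<^sup>2 - 4 * det (coeff_matrix a b k l)))"

definition hopf_freq :: "nat \<Rightarrow> real" where
  "hopf_freq n = pi / 2 + 2 * real n * pi"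

definition tau_plus :: "real \<Rightarrow> real \<Rightarrow> real \<Rightarrow> real \<Rightarrow> nat \<Rightarrow> real" where
  "tau_plus a b k l n =
     hopf_freq n * (((a + b) + sqrt ((a + b)\<^sup>2 - 4 * det (coeff_matrix a b k l)))
                  / (2 * det (coeff_matrix a b k l)))"

definition tau_minus :: "real \<Rightarrow> real \<Rightarrow> real \<Rightarrow> real \<Rightarrow> nat \<Rightarrow> real" where
  "tau_minus a b k l n =
     hopf_freq n * (((a + b) - sqrt ((a + b)\<^sup>2 - 4 * det (coeff_matrix a b k l)))
                  / (2 * det (coeff_matrix a b k l)))"

text \<open>\<open>C\<^sup>\<infinity>\<close> on a (necessarily open) set: \<open>D m\<close> is the \<open>m\<close>-th derivative.\<close>
definition smooth_on :: "real set \<Rightarrow> (real \<Rightarrow> 'v::real_normed_vector) \<Rightarrow> bool" where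
  "smooth_on S f \<longleftrightarrow> open S \<and>
     (\<exists>D :: nat \<Rightarrow> real \<Rightarrow> 'v.
        (\<forall>t\<in>S. D 0 t = f t) \<and>
        (\<forall>m. \<forall>t\<in>S. (D m has_vector_derivative D (Suc m) t) (at t)))"

text \<open>
  The root \<open>\<i> \<omega>\<close> of the normalized characteristic equation at delay \<open>\<tau>0\<close> lies on a smooth
  curve of roots crossing the imaginary axis to the right as the delay increases.
\<close>
definition crosses_to_right ::
  "real \<Rightarrow> real \<Rightarrow> real \<Rightarrow> real \<Rightarrow> real \<Rightarrow> real \<Rightarrow> bool" where
  "crosses_to_right a b k l \<tau>0 \<omega> \<longleftrightarrow>
     (\<exists>\<epsilon>>0. \<exists>r :: real \<Rightarrow> complex.
        smooth_on {\<tau>0 - \<epsilon> <..< \<tau>0 + \<epsilon>} r \<and>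
        (\<forall>s\<in>{\<tau>0 - \<epsilon> <..< \<tau>0 + \<epsilon>}. char_fun a b k l s (r s) = 0) \<and>
        r \<tau>0 = \<i> * of_real \<omega> \<and>
        Re (vector_derivative r (at \<tau>0)) > 0)"

end

theory Submission
  imports Defs "HOL-Complex_Analysis.Conformal_Mappings"
begin

text \<open>
  The matrix \<open>- A\<close> has two distinct real eigenvalues, because its discriminant is
  \<open>(a - b)\<^sup>2 + 4 * k * l > 0\<close>, and both are positive, because their sum is \<open>a + b\<close> and their
  product is \<open>det A\<close>. In eigencoordinates the system splits into two scalar equations
  \<open>u' (t) = - \<mu> * u (t - \<tau>)\<close>, and the characteristic function splits into the two factors
  \<open>z + \<tau> * \<mu> * exp (- z)\<close>. All the claims thus reduce to the scalar equation: it is exponentially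
  stable exactly if \<open>\<mu> * \<tau> < pi / 2\<close> (\<open>scalar_delay_stable_iff\<close>), so the larger eigenvalue alone
  decides, and \<open>tau_crit\<close> is \<open>pi / 2\<close> divided by it.

  Stability of the scalar equation is a statement about power series. With delay \<open>h\<close> and
  \<open>p = \<mu> * h\<close>, integrating step by step expresses \<open>u (n * h)\<close> through the earlier grid values, up
  to a remainder of size \<open>p ^ n / fact n\<close> that carries the initial function
  (\<open>iterated_step_bound\<close>). For the generating function \<open>V\<close> of the grid values this says
  \<open>V (w) * (1 - w * exp (- p * w)) = E (w)\<close> with \<open>E\<close> entire. If \<open>p < pi / 2\<close>, the factor
  \<open>1 - w * exp (- p * w)\<close> has no zero in the closed unit disc (\<open>grid_denominator_nonzero\<close>), hence
  none in a slightly larger disc, and the coefficients of \<open>V\<close> decay geometrically. Since the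
  equation is autonomous, the bound at grid points extends to all times by shifting.

  If \<open>p \<ge> pi / 2\<close>, an intermediate value argument gives a root of \<open>z + p * exp (- z)\<close> with
  \<open>Re z \<ge> 0\<close> (\<open>scalar_char_root_right_half_plane\<close>), and the real part of the corresponding
  exponential solution does not tend to zero.

  A root of a factor is a solution of \<open>z * exp z = - \<tau> * \<mu>\<close>. For \<open>z = \<i> * \<sigma>\<close> with \<open>\<sigma> > 0\<close> this forces
  \<open>sin \<sigma> = 1\<close> and \<open>\<tau> * \<mu> = \<sigma>\<close>, and the curve of roots through such a point is a local holomorphic
  inverse of \<open>z * exp z\<close>, evaluated along the real axis (\<open>crosses_to_right_of_factor\<close>).

  The equilibrium is found by Cramer's rule, whose numerators \<open>b * b1 + k * b2\<close> and
  \<open>l * b1 + a * b2\<close> are positive.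
\<close>

section \<open>Solutions and the phase-space norm\<close>

lemma delay_solution_shift:
  assumes X: "delay_solution \<tau> f \<phi> X" and s: "s \<ge> 0"
  shows "delay_solution \<tau> f (\<lambda>\<theta>. X (\<theta> + s)) (\<lambda>t. X (t + s))"
  unfolding delay_solution_def
proof (intro conjI ballI allI impI refl)
  have "continuous_on {-\<tau>..} X" using X by (simp add: delay_solution_def)
  then show "continuous_on {-\<tau>..} (\<lambda>t. X (t + s))"
    by (rule continuous_on_compose2) (use s in \<open>auto intro!: continuous_intros\<close>)
next
  fix t :: real assume t: "0 \<le> t"
  have "(X has_vector_derivative f (X (t + s - \<tau>))) (at (t + s) within {0..})"
    using X t s by (simp add: delay_solution_def)
  then have "(X has_vector_derivative f (X (t + s - \<tau>))) (at (t + s) within (\<lambda>t. t + s) ` {0..})"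
    by (rule has_vector_derivative_within_subset) (use s in auto)
  then have "((X \<circ> (\<lambda>t. t + s)) has_vector_derivative 1 *\<^sub>R f (X (t + s - \<tau>))) (at t within {0..})"
    by (intro vector_diff_chain_within) (auto intro!: derivative_eq_intros)
  then show "((\<lambda>t. X (t + s)) has_vector_derivative f (X (t - \<tau> + s))) (at t within {0..})"
    by (simp add: o_def algebra_simps)
qed

lemma norm_le_phase_norm:
  assumes "continuous_on {-\<tau>..0} \<phi>" "\<theta> \<in> {-\<tau>..0}"
  shows "norm (\<phi> \<theta>) \<le> phase_norm \<tau> \<phi>"
  unfolding phase_norm_def
proof (rule cSUP_upper[OF assms(2)])
  have "compact ((\<lambda>\<theta>. norm (\<phi> \<theta>)) ` {-\<tau>..0})"
    by (intro compact_continuous_image continuous_on_norm assms(1)) auto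
  then show "bdd_above ((\<lambda>\<theta>. norm (\<phi> \<theta>)) ` {-\<tau>..0})"
    by (intro bounded_imp_bdd_above compact_imp_bounded)
qed

lemma phase_norm_le:
  assumes "\<tau> \<ge> 0" "\<And>\<theta>. \<theta> \<in> {-\<tau>..0} \<Longrightarrow> norm (\<phi> \<theta>) \<le> B"
  shows "phase_norm \<tau> \<phi> \<le> B"
  unfolding phase_norm_def using assms by (intro cSUP_least) auto

section \<open>Stability of the scalar equation below the critical delay\<close>

text \<open>
  Write \<open>u\<^sub>n (s) = u ((n - 1) * h + s)\<close> on \<open>[0, h]\<close>, so that \<open>u\<^sub>0\<close> is the initial function. The
  equation says \<open>u\<^sub>n\<^sub>+\<^sub>1' = - \<mu> * u\<^sub>n\<close>, hence the sum below is the Taylor polynomial of \<open>u\<^sub>n\<close> at \<open>0\<close>, and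
  its remainders satisfy the same recursion with value zero at \<open>s = 0\<close>. Starting from a bound
  \<open>N\<close> on the initial function, each step integrates the previous bound.
\<close>
lemma iterated_step_bound:
  fixes u :: "real \<Rightarrow> real"
  assumes u: "delay_solution h (\<lambda>x. - \<mu> * x) \<phi> u" and "h > 0" "\<mu> > 0"
    and N: "\<And>\<theta>. \<theta> \<in> {-h..0} \<Longrightarrow> \<bar>u \<theta>\<bar> \<le> N"
    and s: "0 \<le> s" "s \<le> h"
  shows "\<bar>u (real n * h - h + s) - (\<Sum>j<n. u (real (n - 1 - j) * h) * ((- \<mu> * s) ^ j / fact j))\<bar>
           \<le> N * ((\<mu> * s) ^ n / fact n)"
  using s
proof (induction n arbitrary: s)
  case 0
  then show ?case using N by simp
next
  case (Suc n)
  define \<rho> where "\<rho> m s = u (real m * h - h + s)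
      - (\<Sum>j<m. u (real (m - 1 - j) * h) * ((- \<mu> * s) ^ j / fact j))" for m s
  have start: "\<rho> (Suc n) 0 = 0"
    by (simp add: \<rho>_def sum.lessThan_Suc_shift algebra_simps del: sum.lessThan_Suc)
  have cont_u: "continuous_on {-h..} u" using u by (simp add: delay_solution_def)
  have cont: "continuous_on {0..s} (\<rho> (Suc n))"
    unfolding \<rho>_def
    by (intro continuous_intros continuous_on_compose2[OF cont_u]) (use \<open>h > 0\<close> in auto)
  have der: "(\<rho> (Suc n) has_real_derivative - \<mu> * \<rho> n t) (at t)" if t: "0 < t" for t
  proof -
    have pos: "real n * h + t > 0" using t \<open>h > 0\<close> by (simp add: add_nonneg_pos)
    have "(u has_vector_derivative - \<mu> * u (real n * h + t - h)) (at (real n * h + t) within {0..})"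
      using u pos by (simp add: delay_solution_def)
    then have du: "(u has_real_derivative - \<mu> * u (real n * h + t - h)) (at (real n * h + t))"
      using pos at_within_interior[of "real n * h + t" "{0..}"]
      by (simp add: has_real_derivative_iff_has_vector_derivative)
    have step: "real (Suc n) * h - h + t = real n * h + t" for t by (simp add: algebra_simps)
    have d1: "((\<lambda>t. u (real (Suc n) * h - h + t)) has_real_derivative
             - \<mu> * u (real n * h - h + t)) (at t)"
    proof -
      have "((\<lambda>t. real n * h + t) has_real_derivative 1) (at t)"
        by (auto intro!: derivative_eq_intros)
      from DERIV_chain2[of u _ "\<lambda>t. real n * h + t" t 1 UNIV, OF du this]
      show ?thesis unfolding step by (simp add: algebra_simps)
    qed
    have d2: "((\<lambda>t. \<Sum>j<Suc n. u (real (Suc n - 1 - j) * h) * ((- \<mu> * t) ^ j / fact j))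
        has_real_derivative
          - \<mu> * (\<Sum>j<n. u (real (n - 1 - j) * h) * ((- \<mu> * t) ^ j / fact j))) (at t)"
    proof -
      have "((\<lambda>t. (- \<mu> * t) ^ Suc j / fact (Suc j)) has_real_derivative
              - \<mu> * ((- \<mu> * t) ^ j / fact j)) (at t)" for j
        by (rule derivative_eq_intros refl | simp del: of_nat_Suc)+
      then have "((\<lambda>t. u (real n * h) + (\<Sum>j<n. u (real (n - Suc j) * h) * ((- \<mu> * t) ^ Suc j / fact (Suc j))))
        has_real_derivative
          0 + (\<Sum>j<n. u (real (n - Suc j) * h) * (- \<mu> * ((- \<mu> * t) ^ j / fact j)))) (at t)"
        by (intro DERIV_add DERIV_sum DERIV_cmult DERIV_const)
      then show ?thesis
        unfolding sum.lessThan_Suc_shift by (simp add: sum_distrib_left mult.left_commute)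
    qed
    show ?thesis
      using DERIV_diff[OF d1 d2] unfolding \<rho>_def by (simp add: algebra_simps)
  qed
  have dB: "((\<lambda>t. N * ((\<mu> * t) ^ Suc n / fact (Suc n))) has_real_derivative
              \<mu> * (N * ((\<mu> * t) ^ n / fact n))) (at t)" for t
    by (rule derivative_eq_intros refl | simp del: of_nat_Suc)+
  have contB: "continuous_on {0..s} (\<lambda>t. N * ((\<mu> * t) ^ Suc n / fact (Suc n)))"
    by (intro continuous_intros) auto
  have IH: "\<bar>\<rho> n t\<bar> \<le> N * ((\<mu> * t) ^ n / fact n)" if "0 \<le> t" "t \<le> s" for t
    using Suc.IH[of t] that Suc.prems by (simp add: \<rho>_def)
  \<comment> \<open>For both signs \<open>c\<close>, the difference between the claimed bound and \<open>c\<close> times the remainder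
    is nondecreasing in \<open>s\<close> and vanishes at \<open>0\<close>.\<close>
  have side: "\<mu> * (N * ((\<mu> * t) ^ n / fact n)) - c * (- \<mu> * \<rho> n t) \<ge> 0"
    if "0 < t" "t < s" "c = 1 \<or> c = -1" for t c
  proof -
    have "N * ((\<mu> * t) ^ n / fact n) + c * \<rho> n t \<ge> 0"
      using IH[of t] that by auto
    then have "\<mu> * (N * ((\<mu> * t) ^ n / fact n) + c * \<rho> n t) \<ge> 0" using \<open>\<mu> > 0\<close> by simp
    then show ?thesis by (simp add: algebra_simps)
  qed
  have mono: "0 \<le> N * ((\<mu> * s) ^ Suc n / fact (Suc n)) - c * \<rho> (Suc n) s"
    if c: "c = 1 \<or> c = -1" for c
  proof -
    have "N * ((\<mu> * 0) ^ Suc n / fact (Suc n)) - c * \<rho> (Suc n) 0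
           \<le> N * ((\<mu> * s) ^ Suc n / fact (Suc n)) - c * \<rho> (Suc n) s"
    proof (rule DERIV_nonneg_imp_increasing_open
        [where f = "\<lambda>s. N * ((\<mu> * s) ^ Suc n / fact (Suc n)) - c * \<rho> (Suc n) s"])
      show "continuous_on {0..s} (\<lambda>s. N * ((\<mu> * s) ^ Suc n / fact (Suc n)) - c * \<rho> (Suc n) s)"
        by (intro continuous_on_diff contB continuous_on_mult cont continuous_on_const)
      show "\<exists>y. ((\<lambda>s. N * ((\<mu> * s) ^ Suc n / fact (Suc n)) - c * \<rho> (Suc n) s)
                 has_real_derivative y) (at t) \<and> 0 \<le> y" if "0 < t" "t < s" for t
        using DERIV_diff[OF dB DERIV_cmult[OF der]] side[OF that c] that by blast
    qed (use Suc.prems in auto)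
    then show ?thesis by (simp add: start)
  qed
  show ?case
    using mono[of 1] mono[of "-1"] unfolding \<rho>_def[of "Suc n", symmetric] by (auto simp: abs_le_iff)
qed

text \<open>
  A zero satisfies \<open>w = exp (p * w)\<close>, so \<open>norm w \<le> 1\<close> forces \<open>Re w \<le> 0\<close>. But the argument \<open>p * Im w\<close>
  of the right-hand side stays within \<open>(- pi / 2, pi / 2)\<close>, which forces \<open>Re w > 0\<close>. Under
  \<open>z = - p * w\<close>, the excluded zeros are the roots of \<open>z + p * exp (- z)\<close> with \<open>Re z \<ge> 0\<close>.
\<close>
lemma grid_denominator_nonzero:
  fixes w :: complex
  assumes "0 < p" "p < pi / 2" "norm w \<le> 1"
  shows "w * exp (- of_real p * w) \<noteq> 1"
proof
  assume eq: "w * exp (- of_real p * w) = 1"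
  have "w = w * exp (- of_real p * w) * exp (of_real p * w)"
    by (simp add: exp_minus)
  then have w: "w = exp (of_real p * w)" unfolding eq by simp
  have "norm w = exp (p * Re w)" by (subst w) simp
  with assms(3) have "exp (p * Re w) \<le> 1" by simp
  then have "Re w \<le> 0" using assms(1) by (simp add: mult_le_0_iff)
  moreover have "Re w = exp (p * Re w) * cos (p * Im w)"
    by (subst w) (simp add: Re_exp)
  moreover have "cos (p * Im w) > 0"
  proof (rule cos_gt_zero_pi)
    have "\<bar>p * Im w\<bar> \<le> p * 1"
      using assms(1) abs_Im_le_cmod[of w] assms(3) by (auto simp: abs_mult intro!: mult_left_mono)
    then show "- (pi / 2) < p * Im w" "p * Im w < pi / 2" using assms(2) by auto
  qed
  ultimately show False by (smt (verit) exp_gt_zero mult_pos_pos)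
qed

text \<open>
  By compactness of the closed unit disc, the denominator is also free of zeros on a disc of
  radius larger than \<open>1\<close>; the reciprocal is analytic there, and its coefficients obey the
  corresponding geometric bound.
\<close>
lemma grid_resolvent_coeff_bound:
  assumes "0 < p" "p < pi / 2"
  obtains R M where "R > 1" "M > 0"
    "\<And>n. norm (fps_nth (inverse (1 - fps_X * fps_exp (- complex_of_real p))) n) \<le> M / R ^ n"
proof -
  define F where "F = 1 - fps_X * fps_exp (- complex_of_real p)"
  have radX: "fps_conv_radius (fps_X * fps_exp (- complex_of_real p)) = \<infinity>"
      using fps_conv_radius_mult[of "fps_X" "fps_exp (- complex_of_real p)"] by simp
  then have rad: "fps_conv_radius F = \<infinity>"
    using fps_conv_radius_diff[of 1 "fps_X * fps_exp (- complex_of_real p)"] by (simp add: F_def)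
  have ev: "eval_fps F w = 1 - w * exp (- of_real p * w)" for w
    unfolding F_def by (subst eval_fps_diff) (simp_all add: eval_fps_mult radX)
  let ?U = "{w. 1 - w * exp (- complex_of_real p * w) \<noteq> 0}"
  have "open ?U"
    by (intro open_Collect_neq continuous_intros)
  moreover have "cball 0 1 \<subseteq> ?U"
    using grid_denominator_nonzero[OF assms] by auto
  ultimately obtain \<epsilon> where \<epsilon>: "\<epsilon> > 0" "(\<Union>x\<in>cball 0 1. cball x \<epsilon>) \<subseteq> ?U"
    using compact_subset_open_imp_cball_epsilon_subset[OF compact_cball] by metis
  have nz: "eval_fps F w \<noteq> 0" if "norm w < 1 + \<epsilon>" for w
  proof -
    have "\<exists>x\<in>cball 0 1. w \<in> cball x \<epsilon>"
    proof (cases "norm w \<le> 1")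
      case True then show ?thesis using \<epsilon> by (intro bexI[of _ w]) auto
    next
      case False
      \<comment> \<open>The radial projection to the unit circle is a point of the closed disc near \<open>w\<close>.\<close>
      then have "w \<noteq> 0" by auto
      from False have "dist (w /\<^sub>R norm w) w = norm w - 1"
      proof -
        have "w /\<^sub>R norm w - w = (1 / norm w - 1) *\<^sub>R w" by (simp add: scaleR_diff_left divide_inverse)
        then have "norm (w /\<^sub>R norm w - w) = \<bar>1 / norm w - 1\<bar> * norm w" by simp
        also have "\<dots> = norm w - 1" using False \<open>w \<noteq> 0\<close> by (simp add: abs_if field_simps)
        finally show ?thesis by (simp add: dist_norm)
      qed
      moreover have "norm (w /\<^sub>R norm w) \<le> 1" using \<open>w \<noteq> 0\<close> by simp
      ultimately show ?thesis using that by (intro bexI[of _ "w /\<^sub>R norm w"]) auto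
    qed
    then have "w \<in> ?U" using \<epsilon>(2) by blast
    then show ?thesis using ev by simp
  qed
  define R where "R = 1 + \<epsilon> / 2"
  have "fps_conv_radius (inverse F) \<ge> min (ereal (1 + \<epsilon>)) (fps_conv_radius F)"
    by (rule fps_conv_radius_inverse) (use nz in \<open>auto simp: rad\<close>)
  then have rad_inv: "fps_conv_radius (inverse F) \<ge> ereal (1 + \<epsilon>)" by (simp add: rad)
  have "ereal (norm (complex_of_real R)) < fps_conv_radius (inverse F)"
    by (rule less_le_trans[OF _ rad_inv]) (use \<epsilon>(1) in \<open>simp only: norm_of_real less_ereal.simps(1)\<close>, simp add: R_def)
  then have "summable (\<lambda>n. fps_nth (inverse F) n * complex_of_real R ^ n)"
    by (rule summable_fps)
  then have "Bseq (\<lambda>n. fps_nth (inverse F) n * complex_of_real R ^ n)"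
    using summable_LIMSEQ_zero convergent_imp_Bseq convergentI by blast
  then obtain M where M: "M > 0" "\<And>n. norm (fps_nth (inverse F) n * complex_of_real R ^ n) \<le> M"
    by (auto elim: BseqE)
  have "R > 1" using \<epsilon>(1) by (simp add: R_def)
  show thesis
  proof (rule that[OF \<open>R > 1\<close> M(1)])
    fix n
    show "norm (fps_nth (inverse (1 - fps_X * fps_exp (- complex_of_real p))) n) \<le> M / R ^ n"
      using M(2)[of n] \<open>R > 1\<close> by (simp add: norm_mult norm_power pos_le_divide_eq F_def)
  qed
qed

text \<open>
  Multiplying the generating function \<open>V\<close> of the grid values by the denominator leaves the series
  \<open>E\<close> of Taylor remainders at \<open>s = h\<close>, which is dominated by \<open>N\<close> times the exponential series. Hence
  \<open>V\<close> is a Cauchy product of a rapidly decaying and a geometrically decaying sequence.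
\<close>
lemma grid_values_bound:
  fixes u :: "real \<Rightarrow> real"
  assumes u: "delay_solution h (\<lambda>x. - \<mu> * x) \<phi> u" and "h > 0" "\<mu> > 0"
    and N: "\<And>\<theta>. \<theta> \<in> {-h..0} \<Longrightarrow> \<bar>u \<theta>\<bar> \<le> N"
    and R: "R > 1"
    and M: "\<And>n. norm (fps_nth (inverse (1 - fps_X * fps_exp (- complex_of_real (\<mu> * h)))) n) \<le> M / R ^ n"
  shows "\<bar>u (real n * h)\<bar> \<le> N * M * exp (\<mu> * h * R) / R ^ n"
proof -
  define p where "p = \<mu> * h"
  have p: "p > 0" using assms by (simp add: p_def)
  define V where "V = Abs_fps (\<lambda>n. complex_of_real (u (real n * h)))"
  define F where "F = 1 - fps_X * fps_exp (- complex_of_real p)"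
  define E where "E = V * F"
  have N0: "N \<ge> 0" using N[of 0] \<open>h > 0\<close> by auto
  have E: "norm (fps_nth E m) \<le> N * (p ^ m / fact m)" for m
  proof -
    have "fps_nth (V * (fps_X * fps_exp (- complex_of_real p))) m
        = fps_nth (fps_X * (V * fps_exp (- complex_of_real p))) m" by (simp add: mult_ac)
    also have "\<dots> = of_real (\<Sum>j<m. u (real (m - 1 - j) * h) * ((- p) ^ j / fact j))"
    proof (cases m)
      case (Suc m')
      have "fps_nth (V * fps_exp (- complex_of_real p)) m'
          = (\<Sum>j\<le>m'. fps_nth V (m' - j) * fps_nth (fps_exp (- complex_of_real p)) j)"
        by (subst mult.commute, subst fps_mult_nth)
           (simp add: atLeast0AtMost mult.commute)
      then show ?thesis using Suc by (simp add: V_def lessThan_Suc_atMost)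
    qed simp
    finally have "fps_nth E m = of_real (u (real m * h) - (\<Sum>j<m. u (real (m - 1 - j) * h) * ((- p) ^ j / fact j)))"
      by (simp add: E_def F_def right_diff_distrib V_def)
    then show ?thesis
      using iterated_step_bound[OF u assms(2,3) N, of h m] \<open>h > 0\<close>
      by (simp only: norm_of_real) (simp add: p_def)
  qed
  have F_bound: "norm (fps_nth (inverse F) m) \<le> M / R ^ m" for m
    using M[of m] by (simp add: F_def p_def)
  have "F * inverse F = 1" by (rule inverse_mult_eq_1') (simp add: F_def)
  then have "V = E * inverse F" by (simp add: E_def mult.assoc)
  then have "norm (fps_nth V n) = norm (\<Sum>i=0..n. fps_nth E i * fps_nth (inverse F) (n - i))"
    by (simp add: fps_mult_nth)
  also have "\<dots> \<le> (\<Sum>i=0..n. N * (p ^ i / fact i) * (M / R ^ (n - i)))"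
    using N0 p by (intro sum_norm_le) (auto simp only: norm_mult intro!: mult_mono E F_bound; simp)
  also have "\<dots> = N * M / R ^ n * (\<Sum>i=0..n. (p * R) ^ i /\<^sub>R fact i)"
    unfolding sum_distrib_left
  proof (rule sum.cong[OF refl])
    fix i assume "i \<in> {0..n}"
    then have "R ^ n = R ^ (n - i) * R ^ i" by (simp flip: power_add)
    then show "N * (p ^ i / fact i) * (M / R ^ (n - i)) = N * M / R ^ n * ((p * R) ^ i /\<^sub>R fact i)"
      using R by (simp add: field_simps)
  qed
  also have "\<dots> \<le> N * M / R ^ n * exp (p * R)"
  proof (rule mult_left_mono)
    have "(\<Sum>i=0..n. (p * R) ^ i /\<^sub>R fact i) \<le> (\<Sum>i. (p * R) ^ i /\<^sub>R fact i)"
      using p R by (intro sum_le_suminf summable_exp_generic) auto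
    then show "(\<Sum>i=0..n. (p * R) ^ i /\<^sub>R fact i) \<le> exp (p * R)" by (simp add: exp_def)
    have "M \<ge> 0" using norm_ge_zero order.trans M[of 0] by fastforce
    then show "0 \<le> N * M / R ^ n" using N0 R by simp
  qed
  finally show ?thesis by (simp add: V_def p_def)
qed

text \<open>
  A time \<open>t\<close> is written as \<open>n * h + s\<close> with \<open>0 \<le> s \<le> h\<close>, and the bound at the grid point \<open>n * h\<close> is
  applied to the solution shifted by \<open>s\<close>. The initial segment of the shifted solution reaches up
  to time \<open>s\<close>, where the first step of the equation gives the factor \<open>1 + \<mu> * h\<close>.
\<close>
lemma scalar_delay_stable:
  assumes "h > 0" "\<mu> > 0" "\<mu> * h < pi / 2"
  shows "exp_asymp_stable h (\<lambda>x. - \<mu> * x) (0::real)"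
proof -
  obtain R M where RM: "R > 1" "M > 0"
    "\<And>n. norm (fps_nth (inverse (1 - fps_X * fps_exp (- complex_of_real (\<mu> * h)))) n) \<le> M / R ^ n"
    using grid_resolvent_coeff_bound[of "\<mu> * h"] assms by auto
  \<comment> \<open>The last factor \<open>R\<close> pays for rounding \<open>t / h\<close> down to an integer.\<close>
  define K where "K = (1 + \<mu> * h) * M * exp (\<mu> * h * R) * R"
  define \<alpha> where "\<alpha> = ln R / h"
  have "K > 0" using RM assms by (simp add: K_def add_pos_pos)
  moreover have "\<alpha> > 0" using RM assms by (simp add: \<alpha>_def)
  moreover have "norm (u t - 0) \<le> K * exp (- \<alpha> * t) * phase_norm h (\<lambda>\<theta>. \<phi> \<theta> - 0)"
    if \<phi>: "continuous_on {-h..0} \<phi>" and u: "delay_solution h (\<lambda>x. - \<mu> * x) \<phi> u" and t: "t \<ge> 0"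
    for \<phi> u and t :: real
  proof -
    define N where "N = phase_norm h \<phi>"
    have N: "\<bar>u \<theta>\<bar> \<le> N" if "\<theta> \<in> {-h..0}" for \<theta>
      using norm_le_phase_norm[OF \<phi> that] u that by (simp add: N_def delay_solution_def)
    have N0: "N \<ge> 0" using N[of 0] assms by auto
    have early: "\<bar>u r\<bar> \<le> (1 + \<mu> * h) * N" if r: "r \<in> {-h..h}" for r
    proof (cases "r \<le> 0")
      case True
      then have "\<bar>u r\<bar> \<le> 1 * N" using N r by simp
      also have "\<dots> \<le> (1 + \<mu> * h) * N" using N0 assms by (intro mult_right_mono) auto
      finally show ?thesis .
    next
      case False
      then have "\<bar>u r - u 0\<bar> \<le> N * (\<mu> * r)"
        using iterated_step_bound[OF u assms(1,2) N, of r 1] r by simp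
      also have "\<dots> \<le> N * (\<mu> * h)" using r False assms N0 by (intro mult_left_mono) auto
      finally show ?thesis using N[of 0] assms by (simp add: algebra_simps)
    qed
    define n where "n = nat \<lfloor>t / h\<rfloor>"
    define s where "s = t - real n * h"
    have n: "real n \<le> t / h" "t / h < real n + 1"
      using t assms by (simp_all add: n_def)
    have s: "0 \<le> s" "s \<le> h" using n assms by (simp_all add: s_def field_simps)
    have "\<bar>u (real n * h + s)\<bar> \<le> (1 + \<mu> * h) * N * M * exp (\<mu> * h * R) / R ^ n"
      by (rule grid_values_bound[OF delay_solution_shift[OF u s(1)] assms(1,2) _ RM(1,3)])
         (use s early in auto)
    then have "\<bar>u t\<bar> \<le> K * N * (1 / (R ^ n * R))"
      using RM(1,2) \<open>h > 0\<close> by (simp add: s_def K_def mult_ac)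
    also have "\<dots> \<le> K * N * exp (- \<alpha> * t)"
    proof (rule mult_left_mono)
      have "\<alpha> * t = t / h * ln R" by (simp add: \<alpha>_def)
      also have "\<dots> \<le> real (Suc n) * ln R" using n RM by (intro mult_right_mono) auto
      finally have "exp (\<alpha> * t) \<le> exp (real (Suc n) * ln R)" by simp
      also have "\<dots> = R ^ Suc n" using RM by (simp add: exp_of_nat_mult del: of_nat_Suc power_Suc)
      finally show "1 / (R ^ n * R) \<le> exp (- \<alpha> * t)"
        using RM by (simp add: exp_minus field_simps)
    qed (use \<open>K > 0\<close> N0 in auto)
    finally show ?thesis by (simp add: N_def mult_ac)
  qed
  ultimately show ?thesis unfolding exp_asymp_stable_def by blast
qed

section \<open>Instability of the scalar equation from the critical delay on\<close>

text \<open>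
  For \<open>z = x + \<i> * y\<close> the equation says \<open>x = - p * exp (- x) * cos y\<close> and \<open>y = p * exp (- x) * sin y\<close>.
  Eliminating \<open>x = - y * cot y\<close> leaves \<open>g y = p\<close> with \<open>g y = y / sin y * exp (- (y * cot y))\<close>. On
  \<open>[pi / 2, pi)\<close> this function starts at \<open>pi / 2\<close> and is unbounded, and there \<open>x \<ge> 0\<close>.
\<close>
lemma scalar_char_root_right_half_plane:
  assumes "p \<ge> pi / 2"
  obtains z :: complex where "z + of_real p * exp (- z) = 0" "Re z \<ge> 0" "Im z > 0"
proof -
  have p: "p > 0" using assms pi_gt_zero by linarith
  define g where "g y = y / sin y * exp (- (y * cot y))" for y :: real
  \<comment> \<open>At this point \<open>sin y1 = pi / (2 * p)\<close>, so the first factor of \<open>g y1\<close> is at least \<open>p\<close>.\<close>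
  define y1 where "y1 = pi - arcsin (pi / (2 * p))"
  have q: "0 < pi / (2 * p)" "pi / (2 * p) \<le> 1" using assms p by (auto simp: field_simps)
  have arc: "0 < arcsin (pi / (2 * p))" "arcsin (pi / (2 * p)) \<le> pi / 2"
    using q arcsin_less_arcsin[of 0 "pi / (2 * p)"] arcsin_bounded[of "pi / (2 * p)"] by auto
  have y1: "pi / 2 \<le> y1" "y1 < pi" using arc by (auto simp: y1_def)
  have sin_pos: "sin y > 0" and cos_neg: "cos y \<le> 0" if "pi / 2 \<le> y" "y \<le> y1" for y
  proof -
    show "sin y > 0" using that y1 pi_gt_zero by (intro sin_gt_zero) linarith+
    have "cos y \<le> cos (pi / 2)" using that y1 by (intro cos_monotone_0_pi_le) auto
    then show "cos y \<le> 0" by simp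
  qed
  have cont: "continuous_on {pi / 2..y1} g"
    unfolding g_def cot_def using sin_pos by (intro continuous_intros) force+
  have "g (pi / 2) \<le> p" using assms by (simp add: g_def cot_def)
  moreover have "p \<le> g y1"
  proof -
    have s: "sin y1 = pi / (2 * p)" using q by (simp add: y1_def)
    have "p \<le> y1 / sin y1" using y1 p by (simp add: s field_simps)
    also have "\<dots> * 1 \<le> g y1"
      unfolding g_def
    proof (rule mult_left_mono)
      have "y1 * cot y1 \<le> 0"
        using sin_pos[of y1] cos_neg[of y1] y1 pi_gt_zero
        by (auto simp: cot_def mult_le_0_iff divide_le_0_iff)
      then show "1 \<le> exp (- (y1 * cot y1))" by simp
      show "0 \<le> y1 / sin y1" using sin_pos[of y1] y1 pi_gt_zero by (intro divide_nonneg_pos) linarith+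
    qed
    finally show ?thesis by simp
  qed
  ultimately obtain y where y: "pi / 2 \<le> y" "y \<le> y1" "g y = p"
    using IVT'[of g "pi / 2" p y1] cont y1 by auto
  define x where "x = - (y * cot y)"
  have ypos: "y > 0" using y pi_gt_zero by linarith
  note s = sin_pos[OF y(1,2)]
  have pe: "p * exp (- x) = y / sin y"
    unfolding y(3)[symmetric] g_def x_def by (simp flip: exp_add)
  show thesis
  proof (rule that[of "Complex x y"])
    have "x + p * exp (- x) * cos y = 0" "y - p * exp (- x) * sin y = 0"
      unfolding pe using s by (simp_all add: x_def cot_def)
    then show "Complex x y + of_real p * exp (- Complex x y) = 0"
      by (simp add: complex_eq_iff Re_exp Im_exp)
    show "Re (Complex x y) \<ge> 0"
      using s cos_neg[OF y(1,2)] ypos by (simp add: x_def cot_def mult_le_0_iff divide_le_0_iff)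
  qed (use ypos in simp)
qed

text \<open>
  A characteristic root in the closed right half-plane, rescaled by \<open>h\<close> to \<open>\<zeta>\<close>, gives the real
  solution \<open>Re (exp (t * \<zeta>))\<close>, which is at least \<open>1\<close> at all nonnegative multiples of the
  period \<open>2 * pi / Im \<zeta>\<close>.
\<close>
lemma scalar_delay_unstable:
  assumes h: "h > 0" and \<mu>: "\<mu> > 0" and stab: "exp_asymp_stable h (\<lambda>x. - \<mu> * x) (0::real)"
  shows "\<mu> * h < pi / 2"
proof (rule ccontr)
  assume "\<not> \<mu> * h < pi / 2"
  then obtain z where z: "z + of_real (\<mu> * h) * exp (- z) = 0" "Re z \<ge> 0" "Im z > 0"
    using scalar_char_root_right_half_plane[of "\<mu> * h"] by auto
  define \<zeta> where "\<zeta> = z / of_real h"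
  have \<zeta>: "\<zeta> = - of_real \<mu> * exp (- (of_real h * \<zeta>))"
    using z(1) h by (simp add: \<zeta>_def field_simps eq_neg_iff_add_eq_0)
  define u where "u t = Re (exp (of_real t * \<zeta>))" for t
  have du: "(u has_vector_derivative - \<mu> * u (t - h)) (at t within {0..})" for t
  proof -
    have "((\<lambda>t. exp (of_real t * \<zeta>)) has_vector_derivative (of_real 1 * \<zeta>) * exp (of_real t * \<zeta>)) (at t within {0..})"
      by (intro field_vector_diff_chain_within[where g = exp, unfolded o_def] derivative_intros
            has_vector_derivative_mult_left has_vector_derivative_of_real DERIV_exp[THEN has_field_derivative_at_within])
    then have "(u has_vector_derivative Re ((of_real 1 * \<zeta>) * exp (of_real t * \<zeta>))) (at t within {0..})"
      unfolding u_def by (rule bounded_linear.has_vector_derivative[OF bounded_linear_Re])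
    also have "(of_real 1 * \<zeta>) * exp (of_real t * \<zeta>)
        = - of_real \<mu> * (exp (- (of_real h * \<zeta>)) * exp (of_real t * \<zeta>))"
      by (subst (1) \<zeta>) simp
    also have "exp (- (of_real h * \<zeta>)) * exp (of_real t * \<zeta>) = exp (of_real (t - h) * \<zeta>)"
      by (simp add: algebra_simps flip: exp_add)
    finally show ?thesis by (simp add: u_def[abs_def])
  qed
  have cont: "continuous_on S u" for S unfolding u_def by (intro continuous_intros)
  have sol: "delay_solution h (\<lambda>x. - \<mu> * x) u u"
    unfolding delay_solution_def using du cont by auto
  obtain K \<alpha> where K: "K > 0" "\<alpha> > 0" and
    all: "\<And>\<phi> X t. continuous_on {-h..0} \<phi> \<Longrightarrow> delay_solution h (\<lambda>x. - \<mu> * x) \<phi> X \<Longrightarrow> t \<ge> 0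
        \<Longrightarrow> norm (X t - 0) \<le> K * exp (- \<alpha> * t) * phase_norm h (\<lambda>\<theta>. \<phi> \<theta> - 0 :: real)"
    using stab unfolding exp_asymp_stable_def by blast
  have decay: "\<bar>u t\<bar> \<le> K * exp (- \<alpha> * t) * phase_norm h u" if "t \<ge> 0" for t
    using all[OF cont sol that] by simp
  define T where "T n = real n * (2 * pi / Im \<zeta>)" for n
  have Im: "Im \<zeta> > 0" and Re: "Re \<zeta> \<ge> 0" using z h by (auto simp: \<zeta>_def)
  have T0: "T n \<ge> 0" for n using Im by (simp add: T_def)
  have "1 \<le> \<bar>u (T n)\<bar>" for n
  proof -
    have "T n * Im \<zeta> = 2 * pi * real n" using Im by (simp add: T_def)
    then have "u (T n) = exp (T n * Re \<zeta>) * cos (2 * pi * real n)"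
      by (simp add: u_def Re_exp)
    also have "cos (2 * pi * real n) = 1" by (simp add: cos_int_2pin[of "int n", simplified])
    finally show ?thesis using T0[of n] Re by simp
  qed
  then have "1 \<le> K * exp (- \<alpha> * T n) * phase_norm h u" for n
    using decay[OF T0, of n] order.trans by blast
  moreover have "(\<lambda>n. K * exp (- \<alpha> * T n) * phase_norm h u) \<longlonglongrightarrow> K * 0 * phase_norm h u"
  proof (intro tendsto_intros)
    have "filterlim T at_top sequentially"
      unfolding T_def using Im
      by (intro filterlim_at_top_mult_tendsto_pos[OF tendsto_const _ filterlim_real_sequentially]) simp
    then have "filterlim (\<lambda>n. - \<alpha> * T n) at_bot sequentially"
      using K(2) by (intro filterlim_tendsto_neg_mult_at_bot[OF tendsto_const]) auto
    then show "(\<lambda>n. exp (- \<alpha> * T n)) \<longlonglongrightarrow> 0"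
      by (rule filterlim_compose[OF exp_at_bot])
  qed
  ultimately have "1 \<le> K * 0 * phase_norm h u" by (intro LIMSEQ_le_const) auto
  then show False by simp
qed

lemma scalar_delay_stable_iff:
  assumes "h > 0" "\<mu> > 0"
  shows "exp_asymp_stable h (\<lambda>x. - \<mu> * x) (0::real) \<longleftrightarrow> \<mu> * h < pi / 2"
  using scalar_delay_stable[OF assms] scalar_delay_unstable[OF assms] by blast

section \<open>Passing between a system and its scalar coordinates\<close>

text \<open>
  Each of \<open>L1\<close> and \<open>L2\<close> maps a solution, centred at \<open>P\<close>, to a solution of a scalar equation. If the
  two values jointly control the norm, decay of both coordinates gives decay of the solution at the
  smaller of the two rates.
\<close>
lemma stable_of_scalar_coordinates:
  fixes F :: "'v::real_normed_vector \<Rightarrow> 'v"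
  assumes L: "bounded_linear L1" "bounded_linear L2" and h: "h > 0"
    and eq: "\<And>Z. L1 (F Z) = - \<mu>1 * L1 (Z - P)" "\<And>Z. L2 (F Z) = - \<mu>2 * L2 (Z - P)"
    and C: "C > 0" "\<And>Z. norm Z \<le> C * (\<bar>L1 Z\<bar> + \<bar>L2 Z\<bar>)"
    and stab: "exp_asymp_stable h (\<lambda>x. - \<mu>1 * x) (0::real)"
      "exp_asymp_stable h (\<lambda>x. - \<mu>2 * x) (0::real)"
  shows "exp_asymp_stable h F P"
proof -
  have coordinate: "\<exists>K>0. \<exists>\<alpha>>0. \<forall>\<phi> X. continuous_on {-h..0} \<phi> \<longrightarrow> delay_solution h F \<phi> X \<longrightarrow>
      (\<forall>t\<ge>0. \<bar>L (X t - P)\<bar> \<le> K * exp (- \<alpha> * t) * phase_norm h (\<lambda>\<theta>. \<phi> \<theta> - P))"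
    if L: "bounded_linear L" and eq: "\<And>Z. L (F Z) = - \<mu> * L (Z - P)"
      and stab: "exp_asymp_stable h (\<lambda>x. - \<mu> * x) (0::real)" for L :: "'v \<Rightarrow> real" and \<mu>
  proof -
    obtain B where B: "B > 0" "\<And>x. \<bar>L x\<bar> \<le> norm x * B"
      using bounded_linear.pos_bounded[OF L] by auto
    obtain K \<alpha> where K: "K > 0" "\<alpha> > 0" and
      decay: "\<And>\<phi> u t. continuous_on {-h..0} \<phi> \<Longrightarrow> delay_solution h (\<lambda>x. - \<mu> * x) \<phi> u \<Longrightarrow> t \<ge> 0
          \<Longrightarrow> norm (u t - 0) \<le> K * exp (- \<alpha> * t) * phase_norm h (\<lambda>\<theta>. \<phi> \<theta> - 0 :: real)"
      using stab unfolding exp_asymp_stable_def by blast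
    have "\<bar>L (X t - P)\<bar> \<le> (K * B) * exp (- \<alpha> * t) * phase_norm h (\<lambda>\<theta>. \<phi> \<theta> - P)"
      if \<phi>: "continuous_on {-h..0} \<phi>" and X: "delay_solution h F \<phi> X" and t: "t \<ge> 0" for \<phi> X t
    proof -
      have L_diff_cont: "continuous_on S (\<lambda>t. L (Y t - P))" if "continuous_on S Y" for S :: "real set" and Y
        by (intro bounded_linear.continuous_on[OF L] continuous_intros that)
      have "delay_solution h (\<lambda>x. - \<mu> * x) (\<lambda>\<theta>. L (\<phi> \<theta> - P)) (\<lambda>t. L (X t - P))"
        unfolding delay_solution_def
      proof (intro conjI ballI allI impI)
        show "continuous_on {-h..} (\<lambda>t. L (X t - P))"
          using X by (intro L_diff_cont) (simp add: delay_solution_def)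
        show "L (X \<theta> - P) = L (\<phi> \<theta> - P)" if "\<theta> \<in> {-h..0}" for \<theta>
          using X that by (simp add: delay_solution_def)
        show "((\<lambda>t. L (X t - P)) has_vector_derivative - \<mu> * L (X (t - h) - P)) (at t within {0..})"
          if "0 \<le> t" for t
        proof -
          have "((\<lambda>t. X t - P) has_vector_derivative F (X (t - h)) - 0) (at t within {0..})"
            using X that
            by (intro has_vector_derivative_diff has_vector_derivative_const) (simp add: delay_solution_def)
          from bounded_linear.has_vector_derivative[OF L this] show ?thesis by (simp add: eq)
        qed
      qed
      from decay[OF L_diff_cont[OF \<phi>] this t]
      have "\<bar>L (X t - P)\<bar> \<le> K * exp (- \<alpha> * t) * phase_norm h (\<lambda>\<theta>. L (\<phi> \<theta> - P))" by simp
      also have "\<dots> \<le> K * exp (- \<alpha> * t) * (phase_norm h (\<lambda>\<theta>. \<phi> \<theta> - P) * B)"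
      proof (rule mult_left_mono)
        show "phase_norm h (\<lambda>\<theta>. L (\<phi> \<theta> - P)) \<le> phase_norm h (\<lambda>\<theta>. \<phi> \<theta> - P) * B"
        proof (rule phase_norm_le)
          fix \<theta> assume "\<theta> \<in> {-h..0}"
          then have "norm (\<phi> \<theta> - P) \<le> phase_norm h (\<lambda>\<theta>. \<phi> \<theta> - P)"
            by (intro norm_le_phase_norm[of h "\<lambda>\<theta>. \<phi> \<theta> - P"] continuous_intros \<phi>)
          then have "norm (\<phi> \<theta> - P) * B \<le> phase_norm h (\<lambda>\<theta>. \<phi> \<theta> - P) * B"
            using B(1) by (intro mult_right_mono) auto
          then show "norm (L (\<phi> \<theta> - P)) \<le> phase_norm h (\<lambda>\<theta>. \<phi> \<theta> - P) * B"
            using B(2)[of "\<phi> \<theta> - P"] by simp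
        qed (use h in simp)
      qed (use K in simp)
      finally show ?thesis by (simp add: mult_ac)
    qed
    then show ?thesis using K B(1) by (intro exI[of _ "K * B"] exI[of _ \<alpha>]) auto
  qed
  obtain K1 \<alpha>1 where 1: "K1 > 0" "\<alpha>1 > 0" "\<And>\<phi> X t. continuous_on {-h..0} \<phi> \<Longrightarrow> delay_solution h F \<phi> X \<Longrightarrow>
      t\<ge>0 \<Longrightarrow> \<bar>L1 (X t - P)\<bar> \<le> K1 * exp (- \<alpha>1 * t) * phase_norm h (\<lambda>\<theta>. \<phi> \<theta> - P)"
    using coordinate[OF L(1) eq(1) stab(1)] by blast
  obtain K2 \<alpha>2 where 2: "K2 > 0" "\<alpha>2 > 0" "\<And>\<phi> X t. continuous_on {-h..0} \<phi> \<Longrightarrow> delay_solution h F \<phi> X \<Longrightarrow>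
      t\<ge>0 \<Longrightarrow> \<bar>L2 (X t - P)\<bar> \<le> K2 * exp (- \<alpha>2 * t) * phase_norm h (\<lambda>\<theta>. \<phi> \<theta> - P)"
    using coordinate[OF L(2) eq(2) stab(2)] by blast
  have "norm (X t - P) \<le> (C * (K1 + K2)) * exp (- min \<alpha>1 \<alpha>2 * t) * phase_norm h (\<lambda>\<theta>. \<phi> \<theta> - P)"
    if \<phi>: "continuous_on {-h..0} \<phi>" and X: "delay_solution h F \<phi> X" and t: "t \<ge> 0" for \<phi> X t
  proof -
    let ?N = "phase_norm h (\<lambda>\<theta>. \<phi> \<theta> - P)"
    have "norm (\<phi> 0 - P) \<le> ?N"
      using h by (intro norm_le_phase_norm[of h "\<lambda>\<theta>. \<phi> \<theta> - P"] continuous_intros \<phi>) auto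
    then have N0: "?N \<ge> 0" by (rule order.trans[OF norm_ge_zero])
    have weaken: "K * exp (- \<alpha> * t) * ?N \<le> K * exp (- min \<alpha>1 \<alpha>2 * t) * ?N"
      if "K > 0" "min \<alpha>1 \<alpha>2 \<le> \<alpha>" for K \<alpha>
      using that t N0 by (intro mult_right_mono mult_left_mono) (auto intro: mult_right_mono simp: min_le_iff_disj)
    have "norm (X t - P) \<le> C * (\<bar>L1 (X t - P)\<bar> + \<bar>L2 (X t - P)\<bar>)" by (rule C(2))
    also have "\<dots> \<le> C * (K1 * exp (- min \<alpha>1 \<alpha>2 * t) * ?N + K2 * exp (- min \<alpha>1 \<alpha>2 * t) * ?N)"
      using C(1) 1(3)[OF \<phi> X t] 2(3)[OF \<phi> X t] weaken[OF 1(1), of \<alpha>1] weaken[OF 2(1), of \<alpha>2]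
      by (intro mult_left_mono add_mono) auto
    finally show ?thesis by (simp add: algebra_simps)
  qed
  moreover have "C * (K1 + K2) > 0" "min \<alpha>1 \<alpha>2 > 0" using C 1 2 by auto
  ultimately show ?thesis unfolding exp_asymp_stable_def by blast
qed

text \<open>
  If the line through \<open>P\<close> in direction \<open>v\<close> is invariant, every scalar solution appears as a
  solution of the system on this line, and inherits its decay.
\<close>
lemma stable_imp_scalar_stable:
  fixes F :: "'v::real_normed_vector \<Rightarrow> 'v"
  assumes stab: "exp_asymp_stable h F P" and h: "h > 0" and v: "v \<noteq> 0"
    and eq: "\<And>c. F (P + c *\<^sub>R v) = (- \<mu> * c) *\<^sub>R v"
  shows "exp_asymp_stable h (\<lambda>x. - \<mu> * x) (0::real)"
proof -
  obtain K \<alpha> where K: "K > 0" "\<alpha> > 0" and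
    decay: "\<And>\<phi> X t. continuous_on {-h..0} \<phi> \<Longrightarrow> delay_solution h F \<phi> X \<Longrightarrow> t \<ge> 0
        \<Longrightarrow> norm (X t - P) \<le> K * exp (- \<alpha> * t) * phase_norm h (\<lambda>\<theta>. \<phi> \<theta> - P)"
    using stab unfolding exp_asymp_stable_def by blast
  have "norm (u t - 0) \<le> K * exp (- \<alpha> * t) * phase_norm h (\<lambda>\<theta>. \<phi> \<theta> - 0)"
    if \<phi>: "continuous_on {-h..0} \<phi>" and u: "delay_solution h (\<lambda>x. - \<mu> * x) \<phi> u" and t: "t \<ge> 0"
    for \<phi> u and t :: real
  proof -
    have "delay_solution h F (\<lambda>\<theta>. P + \<phi> \<theta> *\<^sub>R v) (\<lambda>t. P + u t *\<^sub>R v)"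
      unfolding delay_solution_def
    proof (intro conjI ballI allI impI)
      show "continuous_on {-h..} (\<lambda>t. P + u t *\<^sub>R v)"
        using u by (intro continuous_intros) (simp add: delay_solution_def)
      show "P + u \<theta> *\<^sub>R v = P + \<phi> \<theta> *\<^sub>R v" if "\<theta> \<in> {-h..0}" for \<theta>
        using u that by (simp add: delay_solution_def)
      show "((\<lambda>t. P + u t *\<^sub>R v) has_vector_derivative F (P + u (t - h) *\<^sub>R v)) (at t within {0..})"
        if "0 \<le> t" for t
      proof -
        have "((\<lambda>t. u t *\<^sub>R v) has_vector_derivative (- \<mu> * u (t - h)) *\<^sub>R v) (at t within {0..})"
          using u that
          by (intro bounded_linear.has_vector_derivative[OF bounded_linear_scaleR_left])
             (simp add: delay_solution_def)
        from has_vector_derivative_add[OF has_vector_derivative_const this, of P]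
        show ?thesis by (simp add: eq)
      qed
    qed
    moreover have "continuous_on {-h..0} (\<lambda>\<theta>. P + \<phi> \<theta> *\<^sub>R v)" by (intro continuous_intros \<phi>)
    ultimately have "norm (P + u t *\<^sub>R v - P)
        \<le> K * exp (- \<alpha> * t) * phase_norm h (\<lambda>\<theta>. P + \<phi> \<theta> *\<^sub>R v - P)"
      using decay[of "\<lambda>\<theta>. P + \<phi> \<theta> *\<^sub>R v" "\<lambda>t. P + u t *\<^sub>R v"] t by blast
    then have "\<bar>u t\<bar> * norm v \<le> K * exp (- \<alpha> * t) * phase_norm h (\<lambda>\<theta>. \<phi> \<theta> *\<^sub>R v)" by simp
    also have "\<dots> \<le> K * exp (- \<alpha> * t) * (phase_norm h \<phi> * norm v)"
    proof (rule mult_left_mono)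
      show "phase_norm h (\<lambda>\<theta>. \<phi> \<theta> *\<^sub>R v) \<le> phase_norm h \<phi> * norm v"
        by (rule phase_norm_le) (use h norm_le_phase_norm[OF \<phi>] in \<open>auto intro!: mult_right_mono\<close>)
    qed (use K in simp)
    finally have "\<bar>u t\<bar> * norm v \<le> K * exp (- \<alpha> * t) * phase_norm h \<phi> * norm v" by (simp add: mult_ac)
    then show ?thesis using v by simp
  qed
  then show ?thesis using K unfolding exp_asymp_stable_def by blast
qed

section \<open>Imaginary characteristic roots and their crossing\<close>

text \<open>
  The real and imaginary parts of the equation are \<open>c * cos \<sigma> = 0\<close> and \<open>c * sin \<sigma> = \<sigma>\<close>. Positivity of
  \<open>c\<close> and \<open>\<sigma>\<close> excludes \<open>sin \<sigma> = - 1\<close>, which is why the frequencies are spaced by \<open>2 * pi\<close>.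
\<close>
lemma factor_imaginary_root_iff:
  assumes "\<sigma> > 0" "c > 0"
  shows "\<i> * of_real \<sigma> + of_real c * exp (- (\<i> * of_real \<sigma>)) = 0
           \<longleftrightarrow> c = \<sigma> \<and> (\<exists>n. \<sigma> = hopf_freq n)"
proof -
  have "\<i> * of_real \<sigma> + of_real c * exp (- (\<i> * of_real \<sigma>)) = 0 \<longleftrightarrow> cos \<sigma> = 0 \<and> c * sin \<sigma> = \<sigma>"
    using assms by (auto simp: complex_eq_iff Re_exp Im_exp)
  also have "\<dots> \<longleftrightarrow> c = \<sigma> \<and> sin \<sigma> = 1"
  proof (intro iffI conjI)
    assume *: "cos \<sigma> = 0 \<and> c * sin \<sigma> = \<sigma>"
    then have "(sin \<sigma>)\<^sup>2 = 1" using sin_cos_squared_add[of \<sigma>] by simp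
    moreover have "sin \<sigma> > 0" using * assms by (metis zero_less_mult_pos)
    ultimately show "sin \<sigma> = 1" by (simp add: power2_eq_1_iff)
    with * show "c = \<sigma>" by simp
  next
    assume "c = \<sigma> \<and> sin \<sigma> = 1"
    then show "cos \<sigma> = 0" "c * sin \<sigma> = \<sigma>" using sin_cos_squared_add[of \<sigma>] by auto
  qed
  also have "sin \<sigma> = 1 \<longleftrightarrow> (\<exists>n. \<sigma> = hopf_freq n)"
  proof
    assume "sin \<sigma> = 1"
    then have "cos (\<sigma> - pi / 2) = 1" by (simp add: cos_diff)
    then obtain m :: int where m: "\<sigma> - pi / 2 = of_int m * 2 * pi" by (auto simp: cos_one_2pi_int)
    have "m \<ge> 0"
    proof (rule ccontr)
      assume "\<not> m \<ge> 0"
      then have "of_int m * (2 * pi) \<le> (-1) * (2 * pi)" by (intro mult_right_mono) auto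
      with m assms(1) pi_gt_zero show False by linarith
    qed
    then show "\<exists>n. \<sigma> = hopf_freq n"
      using m by (intro exI[of _ "nat m"]) (simp add: hopf_freq_def)
  next
    assume "\<exists>n. \<sigma> = hopf_freq n"
    then show "sin \<sigma> = 1" by (auto simp: hopf_freq_def sin_add)
  qed
  finally show ?thesis .
qed

lemma hopf_freq_pos: "hopf_freq n > 0"
  by (simp add: hopf_freq_def add_pos_nonneg)

text \<open>
  The equation \<open>z + s * \<mu> * exp (- z) = 0\<close> is equivalent to \<open>z * exp z = - s * \<mu>\<close>, which a local
  holomorphic inverse \<open>g\<close> of \<open>z * exp z\<close> solves for \<open>z\<close>. At \<open>\<xi> = \<i> * \<sigma>\<close>, where \<open>exp \<xi> = \<i>\<close>, the speed of the
  curve \<open>g (- \<mu> * s)\<close> is \<open>- \<mu> / ((1 + \<xi>) * \<i>)\<close>, with real part \<open>\<mu> * \<sigma> / (1 + \<sigma>\<^sup>2) > 0\<close>.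
\<close>
lemma crosses_to_right_of_factor:
  assumes \<mu>: "\<mu> > 0"
    and factor: "\<And>s z. z + of_real (s * \<mu>) * exp (- z) = 0 \<Longrightarrow> char_fun a b k l s z = 0"
  shows "crosses_to_right a b k l (hopf_freq n / \<mu>) (hopf_freq n)"
proof -
  define \<sigma> where "\<sigma> = hopf_freq n"
  have \<sigma>: "\<sigma> > 0" by (simp add: \<sigma>_def hopf_freq_pos)
  define \<xi> where "\<xi> = \<i> * complex_of_real \<sigma>"
  have exp_\<xi>: "exp \<xi> = \<i>"
  proof -
    have "\<xi> + of_real \<sigma> * exp (- \<xi>) = 0"
      using factor_imaginary_root_iff[OF \<sigma> \<sigma>] by (auto simp: \<xi>_def \<sigma>_def)
    then have "of_real \<sigma> * (\<i> * exp \<xi> + 1) = 0"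
      by (simp add: \<xi>_def exp_minus field_simps)
    then have "\<i> * exp \<xi> + 1 = 0" using \<sigma> by simp
    then have "\<i> * (\<i> * exp \<xi> + 1) = 0" by simp
    then show ?thesis by (simp add: algebra_simps)
  qed
  define f :: "complex \<Rightarrow> complex" where "f z = z * exp z" for z
  have holf: "f holomorphic_on UNIV" unfolding f_def by (intro holomorphic_intros)
  have df: "(f has_field_derivative (1 + z) * exp z) (at z)" for z
    unfolding f_def by (auto intro!: derivative_eq_intros simp: algebra_simps)
  have dnz: "deriv f \<xi> \<noteq> 0"
    using DERIV_imp_deriv[OF df, of \<xi>] by (simp add: exp_\<xi>) (simp add: \<xi>_def complex_eq_iff)
  obtain r where r: "r > 0" "open (f ` ball \<xi> r)" "inj_on f (ball \<xi> r)"
    using has_complex_derivative_locally_invertible[OF holf _ _ dnz] by auto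
  define T where "T = f ` ball \<xi> r"
  obtain g where g: "g holomorphic_on T" "\<And>z. z \<in> ball \<xi> r \<Longrightarrow> deriv f z * deriv g (f z) = 1"
      "\<And>z. z \<in> ball \<xi> r \<Longrightarrow> g (f z) = z"
    using holomorphic_has_inverse[OF holomorphic_on_subset[OF holf] _ r(3)] unfolding T_def by auto
  have openT: "open T" using r by (simp add: T_def)
  define \<tau>0 where "\<tau>0 = \<sigma> / \<mu>"
  define c where "c s = complex_of_real (- \<mu> * s)" for s
  have c0: "c \<tau>0 = f \<xi>" using \<mu> unfolding f_def exp_\<xi> by (simp add: c_def \<tau>0_def \<xi>_def complex_eq_iff)
  have "open (c -` T)" using openT unfolding c_def by (intro open_vimage continuous_intros)
  moreover have "\<tau>0 \<in> c -` T" using c0 r(1) by (auto simp: T_def)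
  ultimately obtain \<epsilon> where \<epsilon>: "\<epsilon> > 0" "ball \<tau>0 \<epsilon> \<subseteq> c -` T" by (meson openE)
  define I where "I = {\<tau>0 - \<epsilon> <..< \<tau>0 + \<epsilon>}"
  have I: "c s \<in> T" if "s \<in> I" for s
    using \<epsilon>(2) that by (auto simp: I_def ball_eq_greaterThanLessThan)
  have dc: "(c has_vector_derivative of_real (- \<mu>)) (at s)" for s
    unfolding c_def by (intro has_vector_derivative_of_real derivative_eq_intros) auto
  define D where "D m s = of_real (- \<mu>) ^ m * (deriv ^^ m) g (c s)" for m s
  have dD: "(D m has_vector_derivative D (Suc m) s) (at s)" if "s \<in> I" for m s
  proof -
    have "((deriv ^^ m) g \<circ> c has_vector_derivative of_real (- \<mu>) * (deriv ^^ Suc m) g (c s)) (at s)"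
      by (rule field_vector_diff_chain_at[OF dc has_field_derivative_higher_deriv[OF g(1) openT I[OF that]]])
    then have "((\<lambda>s. of_real (- \<mu>) ^ m * (deriv ^^ m) g (c s)) has_vector_derivative
        of_real (- \<mu>) ^ m * (of_real (- \<mu>) * (deriv ^^ Suc m) g (c s))) (at s)"
      by (intro has_vector_derivative_mult_right) (simp add: o_def)
    then show ?thesis by (simp add: D_def[abs_def] mult_ac)
  qed
  have D0: "D 0 = (\<lambda>s. g (c s))" by (simp add: D_def fun_eq_iff)
  have "smooth_on I (\<lambda>s. g (c s))"
    unfolding smooth_on_def using dD D0
    by (intro conjI exI[of _ D]) (simp_all add: I_def)
  moreover have "char_fun a b k l s (g (c s)) = 0" if "s \<in> I" for s
  proof (rule factor)
    from I[OF that] obtain z where z: "z \<in> ball \<xi> r" "c s = f z" by (auto simp: T_def)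
    then have "of_real (s * \<mu>) = - (z * exp z)" by (simp add: c_def f_def minus_equation_iff mult.commute)
    then show "g (c s) + of_real (s * \<mu>) * exp (- g (c s)) = 0"
      using z g(3) by (simp add: exp_minus)
  qed
  moreover have "g (c \<tau>0) = \<xi>" using c0 g(3) r(1) by simp
  moreover have "Re (vector_derivative (\<lambda>s. g (c s)) (at \<tau>0)) > 0"
  proof -
    have "\<tau>0 \<in> I" using \<epsilon>(1) by (simp add: I_def)
    from dD[OF this, of 0] have "vector_derivative (\<lambda>s. g (c s)) (at \<tau>0) = D 1 \<tau>0"
      by (simp add: D0 vector_derivative_at)
    also have "\<dots> = - of_real \<mu> * deriv g (f \<xi>)" by (simp add: D_def c0)
    also have "deriv g (f \<xi>) = 1 / ((1 + \<xi>) * \<i>)"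
      using g(2)[of \<xi>] r(1) dnz DERIV_imp_deriv[OF df, of \<xi>]
      by (auto simp: exp_\<xi> field_simps)
    also have "Re (- of_real \<mu> * (1 / ((1 + \<xi>) * \<i>))) = \<mu> * \<sigma> / (1 + \<sigma>\<^sup>2)"
      by (simp add: \<xi>_def Re_divide power2_eq_square add.commute)
    finally show ?thesis using \<mu> \<sigma> by (simp add: add_pos_nonneg)
  qed
  ultimately show ?thesis
    unfolding crosses_to_right_def
    using \<epsilon>(1) by (intro exI[of _ \<epsilon>] conjI exI[of _ "\<lambda>s. g (c s)"]) (auto simp: I_def \<tau>0_def \<sigma>_def \<xi>_def)
qed

section \<open>The eigenvalues of the coefficient matrix and the equilibrium\<close>

text \<open>
  The two eigenvalues of \<open>- A\<close>, which are the rates \<open>\<mu>\<close> of the scalar equations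
  \<open>u' (t) = - \<mu> * u (t - \<tau>)\<close> into which the system decouples.
\<close>
definition decay_fast :: "real \<Rightarrow> real \<Rightarrow> real \<Rightarrow> real \<Rightarrow> real" where
  "decay_fast a b k l = ((a + b) + sqrt ((a + b)\<^sup>2 - 4 * det (coeff_matrix a b k l))) / 2"

definition decay_slow :: "real \<Rightarrow> real \<Rightarrow> real \<Rightarrow> real \<Rightarrow> real" where
  "decay_slow a b k l = ((a + b) - sqrt ((a + b)\<^sup>2 - 4 * det (coeff_matrix a b k l))) / 2"

lemma det_coeff_matrix: "det (coeff_matrix a b k l) = a * b - k * l"
  by (simp add: coeff_matrix_def det_2)

lemma decay_rates_sum: "decay_fast a b k l + decay_slow a b k l = a + b"
  by (simp add: decay_fast_def decay_slow_def field_simps)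

lemma discriminant_pos:
  assumes "k > 0" "l > 0"
  shows "(a + b)\<^sup>2 - 4 * det (coeff_matrix a b k l) > 0"
proof -
  have "(a + b)\<^sup>2 - 4 * det (coeff_matrix a b k l) = (a - b)\<^sup>2 + 4 * (k * l)"
    by (simp add: det_coeff_matrix power2_eq_square algebra_simps)
  then show ?thesis using assms by (simp add: add_nonneg_pos)
qed

lemma decay_rates_prod:
  assumes "k > 0" "l > 0"
  shows "decay_fast a b k l * decay_slow a b k l = det (coeff_matrix a b k l)"
proof -
  define D where "D = (a + b)\<^sup>2 - 4 * det (coeff_matrix a b k l)"
  have "decay_fast a b k l * decay_slow a b k l = ((a + b)\<^sup>2 - (sqrt D)\<^sup>2) / 4"
    by (simp add: decay_fast_def decay_slow_def D_def power2_eq_square algebra_simps)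
  also have "(sqrt D)\<^sup>2 = D" using discriminant_pos[OF assms] by (simp add: D_def less_imp_le)
  finally show ?thesis by (simp add: D_def)
qed

lemma decay_rates_order:
  assumes "a > 0" "b > 0" "k > 0" "l > 0" "det (coeff_matrix a b k l) > 0"
  shows "0 < decay_slow a b k l" "decay_slow a b k l < decay_fast a b k l"
proof -
  have "sqrt ((a + b)\<^sup>2 - 4 * det (coeff_matrix a b k l)) > 0" using discriminant_pos assms by simp
  then show "decay_slow a b k l < decay_fast a b k l" by (simp add: decay_fast_def decay_slow_def)
  moreover have "decay_fast a b k l * decay_slow a b k l > 0"
    using decay_rates_prod assms by simp
  moreover have "decay_fast a b k l + decay_slow a b k l > 0"
    using decay_rates_sum assms by simp
  ultimately show "0 < decay_slow a b k l" by (auto simp: zero_less_mult_iff)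
qed

lemma char_fun_factorization:
  assumes "k > 0" "l > 0"
  shows "char_fun a b k l \<tau> z = (z + of_real (\<tau> * decay_fast a b k l) * exp (- z))
                                 * (z + of_real (\<tau> * decay_slow a b k l) * exp (- z))"
proof -
  have "exp (- 2 * z) = exp (- z) * exp (- z)" by (simp flip: exp_add)
  then show ?thesis
    unfolding char_fun_def decay_rates_prod[OF assms, symmetric] decay_rates_sum[symmetric, of a b k l]
    by (simp add: power2_eq_square algebra_simps)
qed

text \<open>
  The characteristic equation of \<open>- A\<close>, in the form that makes \<open>(l, a - \<mu>)\<close> a left and \<open>(k, a - \<mu>)\<close> a
  right eigenvector.
\<close>
lemma decay_rate_eigen:
  assumes "k > 0" "l > 0" "\<mu> = decay_fast a b k l \<or> \<mu> = decay_slow a b k l"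
  shows "(a - \<mu>) * (b - \<mu>) = k * l"
proof -
  have "(\<mu> - decay_fast a b k l) * (\<mu> - decay_slow a b k l) = 0" using assms(3) by auto
  then have "\<mu> * \<mu> - (decay_fast a b k l + decay_slow a b k l) * \<mu>
      + decay_fast a b k l * decay_slow a b k l = 0" by (simp add: algebra_simps)
  then show ?thesis
    unfolding decay_rates_prod[OF assms(1,2)] decay_rates_sum det_coeff_matrix by (simp add: algebra_simps)
qed

lemma equilibrium_iff:
  assumes "a * b - k * l \<noteq> 0"
  shows "equilibrium (delay_field a b k l b1 b2) P \<longleftrightarrow>
           P $ 1 = (b * b1 + k * b2) / (a * b - k * l) \<and> P $ 2 = (l * b1 + a * b2) / (a * b - k * l)"
proof -
  have "equilibrium (delay_field a b k l b1 b2) P \<longleftrightarrow>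
      k * P $ 2 - a * P $ 1 + b1 = 0 \<and> l * P $ 1 - b * P $ 2 + b2 = 0"
    by (simp add: equilibrium_def delay_field_def vec_eq_iff forall_2)
  also have "\<dots> \<longleftrightarrow> P $ 1 * (a * b - k * l) = b * b1 + k * b2 \<and> P $ 2 * (a * b - k * l) = l * b1 + a * b2"
  proof (intro iffI conjI)
    assume *: "k * P $ 2 - a * P $ 1 + b1 = 0 \<and> l * P $ 1 - b * P $ 2 + b2 = 0"
    show "P $ 1 * (a * b - k * l) = b * b1 + k * b2" using * by algebra
    show "P $ 2 * (a * b - k * l) = l * b1 + a * b2" using * by algebra
  next
    assume *: "P $ 1 * (a * b - k * l) = b * b1 + k * b2 \<and> P $ 2 * (a * b - k * l) = l * b1 + a * b2"
    have "(a * b - k * l) * (k * P $ 2 - a * P $ 1 + b1) = 0" using * by algebra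
    then show "k * P $ 2 - a * P $ 1 + b1 = 0" using assms by simp
    have "(a * b - k * l) * (l * P $ 1 - b * P $ 2 + b2) = 0" using * by algebra
    then show "l * P $ 1 - b * P $ 2 + b2 = 0" using assms by simp
  qed
  finally show ?thesis using assms by (simp add: eq_divide_eq)
qed

lemma equilibrium_P0:
  assumes "det (coeff_matrix a b k l) \<noteq> 0"
  shows "equilibrium (delay_field a b k l b1 b2) (P0 a b k l b1 b2)"
proof -
  let ?A = "coeff_matrix a b k l"
  have "\<exists>B. ?A ** B = mat 1 \<and> B ** ?A = mat 1"
    using assms invertible_det_nz[of ?A] by (simp add: invertible_def)
  then have inv: "?A ** matrix_inv ?A = mat 1"
    unfolding matrix_inv_def by (rule someI2_ex) auto
  have field: "delay_field a b k l b1 b2 Z = ?A *v Z + vector [b1, b2]" for Z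
    by (simp add: delay_field_def coeff_matrix_def vec_eq_iff forall_2 matrix_vector_mult_def sum_2)
  have "?A *v P0 a b k l b1 b2 = - vector [b1, b2]"
    unfolding P0_def by (simp add: matrix_vector_mul_assoc inv vec.neg)
  then show ?thesis by (simp add: equilibrium_def field)
qed

section \<open>The planar system\<close>

lemma delay_field_components [simp]:
  "delay_field a b k l b1 b2 Z $ 1 = k * Z $ 2 - a * Z $ 1 + b1"
  "delay_field a b k l b1 b2 Z $ 2 = l * Z $ 1 - b * Z $ 2 + b2"
  by (simp_all add: delay_field_def)

lemma left_eigen_coordinate:
  assumes P: "equilibrium (delay_field a b k l b1 b2) P" and \<mu>: "(a - \<mu>) * (b - \<mu>) = k * l"
  defines "L \<equiv> \<lambda>Z :: real^2. l * Z $ 1 + (a - \<mu>) * Z $ 2"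
  shows "bounded_linear L" "L (delay_field a b k l b1 b2 Z) = - \<mu> * L (Z - P)"
proof -
  show "bounded_linear L" unfolding L_def
    by (intro bounded_linear_add bounded_linear_const_mult bounded_linear_vec_nth)
  have "k * P $ 2 - a * P $ 1 + b1 = 0" "l * P $ 1 - b * P $ 2 + b2 = 0"
    using P unfolding equilibrium_def by (simp_all add: vec_eq_iff forall_2)
  then show "L (delay_field a b k l b1 b2 Z) = - \<mu> * L (Z - P)"
    using \<mu> unfolding L_def delay_field_components vector_minus_component by algebra
qed

lemma right_eigen_direction:
  assumes P: "equilibrium (delay_field a b k l b1 b2) P" and \<mu>: "(a - \<mu>) * (b - \<mu>) = k * l"
  shows "delay_field a b k l b1 b2 (P + c *\<^sub>R vector [k, a - \<mu>]) = (- \<mu> * c) *\<^sub>R vector [k, a - \<mu>]"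
proof -
  have P': "k * P $ 2 - a * P $ 1 + b1 = 0" "l * P $ 1 - b * P $ 2 + b2 = 0"
    using P unfolding equilibrium_def by (simp_all add: vec_eq_iff forall_2)
  have "k * (P $ 2 + c * (a - \<mu>)) - a * (P $ 1 + c * k) + b1 = - \<mu> * c * k"
    using P'(1) by algebra
  moreover have "l * (P $ 1 + c * k) - b * (P $ 2 + c * (a - \<mu>)) + b2 = - \<mu> * c * (a - \<mu>)"
    using P'(2) \<mu> by algebra
  ultimately show ?thesis by (simp add: vec_eq_iff forall_2)
qed

text \<open>
  Since the smaller eigenvalue gives a stable scalar equation whenever the larger one does, only
  the larger one matters. The left eigenvectors \<open>(l, a - \<mu>)\<close> of the two eigenvalues have the same
  first entry \<open>l \<noteq> 0\<close> and different second entries, so they determine the state; the constant \<open>C\<close>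
  bounds the inverse of this change of coordinates.
\<close>
lemma delay_system_stable_iff:
  assumes pos: "a > 0" "b > 0" "k > 0" "l > 0" "det (coeff_matrix a b k l) > 0" and h: "h > 0"
    and P: "equilibrium (delay_field a b k l b1 b2) P"
  shows "exp_asymp_stable h (delay_field a b k l b1 b2) P \<longleftrightarrow> decay_fast a b k l * h < pi / 2"
proof
  let ?\<mu> = "decay_fast a b k l"
  assume stab: "exp_asymp_stable h (delay_field a b k l b1 b2) P"
  have "exp_asymp_stable h (\<lambda>x. - ?\<mu> * x) (0::real)"
  proof (rule stable_imp_scalar_stable[OF stab h])
    show "(vector [k, a - ?\<mu>] :: real^2) \<noteq> 0"
      using \<open>k > 0\<close> by (simp add: vec_eq_iff forall_2)
  qed (rule right_eigen_direction[OF P decay_rate_eigen[OF pos(3,4) disjI1[OF refl]]])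
  then show "?\<mu> * h < pi / 2"
    using scalar_delay_stable_iff[OF h] decay_rates_order[OF pos] by simp
next
  let ?\<mu> = "decay_fast a b k l" and ?\<nu> = "decay_slow a b k l"
  assume fast: "?\<mu> * h < pi / 2"
  note order = decay_rates_order[OF pos]
  have "?\<nu> * h < ?\<mu> * h" using order(2) h by simp
  with fast have slow: "?\<nu> * h < pi / 2" by linarith
  define \<delta> where "\<delta> = ?\<mu> - ?\<nu>"
  have \<delta>: "\<delta> > 0" using order by (simp add: \<delta>_def)
  define C where "C = (1 + \<bar>a - ?\<mu>\<bar> / \<delta>) / l + 1 / \<delta>"
  note coord = left_eigen_coordinate[OF P decay_rate_eigen[OF pos(3,4)]]
  show "exp_asymp_stable h (delay_field a b k l b1 b2) P"
  proof (rule stable_of_scalar_coordinates[OF coord(1)[OF disjI1[OF refl]]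
        coord(1)[OF disjI2[OF refl]] h coord(2)[OF disjI1[OF refl]] coord(2)[OF disjI2[OF refl]]])
    show "C > 0" using \<delta> pos by (simp add: C_def add_pos_pos add_pos_nonneg)
    show "norm Z \<le> C * (\<bar>l * Z $ 1 + (a - ?\<mu>) * Z $ 2\<bar> + \<bar>l * Z $ 1 + (a - ?\<nu>) * Z $ 2\<bar>)"
      for Z :: "real^2"
    proof -
      define u where "u = l * Z $ 1 + (a - ?\<mu>) * Z $ 2"
      define w where "w = l * Z $ 1 + (a - ?\<nu>) * Z $ 2"
      define S where "S = \<bar>u\<bar> + \<bar>w\<bar>"
      have "Z $ 2 = (w - u) / \<delta>" using \<delta> by (simp add: u_def w_def \<delta>_def field_simps)
      then have z2: "\<bar>Z $ 2\<bar> \<le> S / \<delta>" using \<delta> by (simp add: S_def divide_right_mono)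
      have "Z $ 1 = (u - (a - ?\<mu>) * Z $ 2) / l" using pos by (simp add: u_def field_simps)
      then have "\<bar>Z $ 1\<bar> \<le> (\<bar>u\<bar> + \<bar>a - ?\<mu>\<bar> * \<bar>Z $ 2\<bar>) / l"
        using pos by (simp add: divide_right_mono flip: abs_mult)
      also have "\<dots> \<le> (S + \<bar>a - ?\<mu>\<bar> * (S / \<delta>)) / l"
        using pos z2 by (intro divide_right_mono add_mono mult_left_mono) (auto simp: S_def)
      finally have "\<bar>Z $ 1\<bar> + \<bar>Z $ 2\<bar> \<le> (S + \<bar>a - ?\<mu>\<bar> * (S / \<delta>)) / l + S / \<delta>" using z2 by simp
      also have "\<dots> = C * S" using \<delta> pos by (simp add: C_def field_simps)
      finally show ?thesis using norm_le_l1_cart[of Z] by (simp add: sum_2 S_def u_def w_def)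
    qed
    show "exp_asymp_stable h (\<lambda>x. - ?\<mu> * x) (0::real)"
      using scalar_delay_stable_iff[OF h, of ?\<mu>] order fast by simp
    show "exp_asymp_stable h (\<lambda>x. - ?\<nu> * x) (0::real)"
      using scalar_delay_stable_iff[OF h, of ?\<nu>] order slow by simp
  qed
qed

text \<open>
  By \<open>det A = \<mu> * \<nu>\<close> for the eigenvalues \<open>\<mu>\<close> and \<open>\<nu>\<close>, dividing one of them by \<open>det A\<close> gives the
  reciprocal of the other. So \<open>tau_plus\<close> belongs to the smaller eigenvalue and \<open>tau_minus\<close> to the
  larger one.
\<close>
lemma critical_delays:
  assumes "a > 0" "b > 0" "k > 0" "l > 0" "det (coeff_matrix a b k l) > 0"
  shows "tau_crit a b k l = pi / (2 * decay_fast a b k l)"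
    "tau_plus a b k l n = hopf_freq n / decay_slow a b k l"
    "tau_minus a b k l n = hopf_freq n / decay_fast a b k l"
proof -
  let ?\<mu> = "decay_fast a b k l" and ?\<nu> = "decay_slow a b k l"
  note order = decay_rates_order[OF assms]
  have det: "det (coeff_matrix a b k l) = ?\<mu> * ?\<nu>" using decay_rates_prod assms by simp
  have fast: "(a + b) + sqrt ((a + b)\<^sup>2 - 4 * det (coeff_matrix a b k l)) = 2 * ?\<mu>"
    and slow: "(a + b) - sqrt ((a + b)\<^sup>2 - 4 * det (coeff_matrix a b k l)) = 2 * ?\<nu>"
    by (simp_all add: decay_fast_def decay_slow_def)
  show "tau_crit a b k l = pi / (2 * ?\<mu>)"
    unfolding tau_crit_def slow unfolding det using order by (simp add: field_simps)
  show "tau_plus a b k l n = hopf_freq n / ?\<nu>"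
    unfolding tau_plus_def fast unfolding det using order by (simp add: field_simps)
  show "tau_minus a b k l n = hopf_freq n / ?\<mu>"
    unfolding tau_minus_def slow unfolding det using order by (simp add: field_simps)
qed

lemma char_fun_imaginary_root_iff:
  assumes pos: "a > 0" "b > 0" "k > 0" "l > 0" "det (coeff_matrix a b k l) > 0"
    and "\<tau> > 0" "\<sigma> > 0"
  shows "char_fun a b k l \<tau> (\<i> * of_real \<sigma>) = 0
     \<longleftrightarrow> (\<exists>n. \<sigma> = hopf_freq n \<and> (\<tau> = tau_plus a b k l n \<or> \<tau> = tau_minus a b k l n))"
proof -
  note order = decay_rates_order[OF pos]
  have "char_fun a b k l \<tau> (\<i> * of_real \<sigma>) = 0 \<longleftrightarrow>
      (\<tau> * decay_fast a b k l = \<sigma> \<or> \<tau> * decay_slow a b k l = \<sigma>) \<and> (\<exists>n. \<sigma> = hopf_freq n)"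
    using factor_imaginary_root_iff[of \<sigma> "\<tau> * decay_fast a b k l"]
      factor_imaginary_root_iff[of \<sigma> "\<tau> * decay_slow a b k l"] assms order
    unfolding char_fun_factorization[OF pos(3,4)] mult_eq_0_iff by auto
  also have "\<dots> \<longleftrightarrow> (\<exists>n. \<sigma> = hopf_freq n \<and> (\<tau> = \<sigma> / decay_slow a b k l \<or> \<tau> = \<sigma> / decay_fast a b k l))"
    using order by (auto simp: field_simps)
  finally show ?thesis unfolding critical_delays[OF pos] by metis
qed

lemma char_fun_cnj: "char_fun a b k l \<tau> (cnj z) = cnj (char_fun a b k l \<tau> z)"
  by (simp add: char_fun_def exp_cnj)

theorem theorem2p1:
  fixes a b k l b1 b2 \<tau> :: real
  assumes "a > 0" "b > 0" "k > 0" "l > 0" "b1 > 0" "b2 > 0" "\<tau> > 0"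
    and "det (coeff_matrix a b k l) > 0"
  shows "(\<forall>P. equilibrium (delay_field a b k l b1 b2) P \<longleftrightarrow> P = P0 a b k l b1 b2)
       \<and> P0 a b k l b1 b2 $ 1 > 0 \<and> P0 a b k l b1 b2 $ 2 > 0
       \<and> (exp_asymp_stable \<tau> (delay_field a b k l b1 b2) (P0 a b k l b1 b2)
            \<longleftrightarrow> \<tau> < tau_crit a b k l)
       \<and> (\<forall>\<sigma>>0. (char_fun a b k l \<tau> (\<i> * of_real \<sigma>) = 0 \<and>
                   char_fun a b k l \<tau> (- (\<i> * of_real \<sigma>)) = 0)
              \<longleftrightarrow> (\<exists>n. \<sigma> = hopf_freq n \<and> (\<tau> = tau_plus a b k l n \<or> \<tau> = tau_minus a b k l n)))
       \<and> (\<forall>n. crosses_to_right a b k l (tau_plus a b k l n) (hopf_freq n)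
            \<and> crosses_to_right a b k l (tau_minus a b k l n) (hopf_freq n))"
proof (intro conjI allI impI)
  let ?F = "delay_field a b k l b1 b2" and ?P = "P0 a b k l b1 b2"
  note pos = assms(1-4,8)
  have det: "a * b - k * l > 0" using assms(8) by (simp add: det_coeff_matrix)
  have eq: "equilibrium ?F ?P" using equilibrium_P0 assms(8) by simp
  note solve = equilibrium_iff[OF less_imp_neq[OF det, symmetric], of b1 b2]
  show "equilibrium ?F P \<longleftrightarrow> P = ?P" for P
    using solve[of P] solve[of ?P] eq by (auto simp: vec_eq_iff forall_2)
  show "?P $ 1 > 0" "?P $ 2 > 0"
    using solve[of ?P] eq det assms by (auto intro!: divide_pos_pos add_pos_pos)
  show "exp_asymp_stable \<tau> ?F ?P \<longleftrightarrow> \<tau> < tau_crit a b k l"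
    using delay_system_stable_iff[OF pos assms(7) eq] decay_rates_order[OF pos]
    unfolding critical_delays[OF pos] by (simp add: field_simps)
  show "(char_fun a b k l \<tau> (\<i> * of_real \<sigma>) = 0 \<and> char_fun a b k l \<tau> (- (\<i> * of_real \<sigma>)) = 0)
      \<longleftrightarrow> (\<exists>n. \<sigma> = hopf_freq n \<and> (\<tau> = tau_plus a b k l n \<or> \<tau> = tau_minus a b k l n))"
    if "\<sigma> > 0" for \<sigma>
    using char_fun_imaginary_root_iff[OF pos assms(7) that]
      char_fun_cnj[of a b k l \<tau> "\<i> * of_real \<sigma>"] by auto
  show "crosses_to_right a b k l (tau_plus a b k l n) (hopf_freq n)"
    "crosses_to_right a b k l (tau_minus a b k l n) (hopf_freq n)" for n
    unfolding critical_delays[OF pos] using decay_rates_order[OF pos]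
    by (auto intro!: crosses_to_right_of_factor simp: char_fun_factorization[OF pos(3,4)])
qed

end
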